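(* Let $\mathcal H$ be a real Hilbert space and let $F:\mathcal H\to\mathcal H$ be a monotone, $L$-Lipschitz operator with $L>0$ and a solution $x^*\in\mathcal H$ such that $F(x^* )=0$. Let $x_0\in\mathcal H$ and let $R:=\|x_0-x^*\|$. Let $\eta=\frac{1}{8L}$ and $\delta_k=\frac{4}{k+32}$ for $k\ge0$, let $G_k(x):=\eta F(x)+\delta_k(x-x_0)$, and consider the regularized extragradient method started at $x_0$, $$x_{k+1/2}=x_k-G_k(x_k),\qquad x_{k+1}=x_k-G_k(x_{k+1/2}),\qquad k\ge0.$$ Then, for all $k\ge1$, $$\|F(x_k)\|\le\frac{128LR}{k+31}.$$
   Context: An operator $F:\mathcal H\to\mathcal H$ on a real Hilbert space is monotone if $\langle F(x)-F(y),x-y\rangle\ge0$ for all $x,y\in\mathcal H$, and $L$-Lipschitz if $\|F(x)-F(y)\|\le L\|x-y\|$ for all $x,y\in\mathcal H$. The half-integer index in $x_{k+1/2}$ is only a label for the auxiliary (lookahead) point. *)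

theory Defs
  imports "HOL-Analysis.Analysis"
begin

(* Order-theoretic monotonicity (HOL's monotone, mono) is a different notion. *)
definition monotone_operator :: "('a::real_inner \<Rightarrow> 'a) \<Rightarrow> bool" where
  "monotone_operator F \<longleftrightarrow> (\<forall>x y. (F x - F y) \<bullet> (x - y) \<ge> 0)"

end

theory Submission
  imports Defs
begin

text \<open>
  Each step is an extragradient step with unit step size for \<open>G k\<close>, which is \<open>\<delta> k\<close>-strongly
  monotone and 1/4-Lipschitz. Such a step shrinks the residual \<open>norm (G k (x k))\<close> by the factor
  \<open>1 - 2/3 * \<delta> k\<close>, and it keeps \<open>norm (x k - xstar)\<^sup>2 \<le> 3/2 * R\<^sup>2\<close>, so that
  \<open>norm (x k - x0) \<le> 9/4 * R\<close>. Passing from \<open>G k\<close> to \<open>G (Suc k)\<close> therefore costs only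
  \<open>(\<delta> k - \<delta> (Suc k)) * 9/4 * R = O(R / k\<^sup>2)\<close>, and induction gives
  \<open>norm (G k (x k)) \<le> 7 * R / (k + 32)\<close>. Since \<open>\<delta> k * norm (x k - x0) \<le> 9 * R / (k + 32)\<close>,
  we get \<open>\<eta> * norm (F (x k)) \<le> 16 * R / (k + 32)\<close>.
\<close>

text \<open>Young's inequality for \<open>v = w + (v - w)\<close>; the defect is half of
  \<open>(norm (2 *\<^sub>R v - 3 *\<^sub>R w))\<^sup>2\<close>. The weight 3/2 is the source of the
  rate \<open>2/3 * \<mu>\<close> in the two lemmas below.\<close>

lemma norm_square_young:
  fixes v w :: "'a::real_inner"
  shows "(norm v)\<^sup>2 \<le> 3/2 * (norm w)\<^sup>2 + 3 * (norm (v - w))\<^sup>2"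
proof -
  have "0 \<le> (norm (2 *\<^sub>R v - 3 *\<^sub>R w))\<^sup>2"
    by simp
  also have "\<dots> = 2 * (3/2 * (norm w)\<^sup>2 + 3 * (norm (v - w))\<^sup>2 - (norm v)\<^sup>2)"
    by (simp add: power2_norm_eq_inner algebra_simps inner_commute)
  finally show ?thesis
    by simp
qed

text \<open>With g, h, p the values of \<open>G\<close> at the start, lookahead and end points, the
  identity \<open>id\<close> expresses \<open>(norm p)\<^sup>2\<close> through \<open>g\<close>,
  \<open>h - p\<close> and \<open>h - g\<close>. Strong monotonicity between start and end points,
  which differ by h, yields a decrease of \<open>2 * \<mu> * (norm h)\<^sup>2\<close>. The Lipschitz
  bound leaves 15/16 of \<open>(norm (h - g))\<^sup>2\<close> to pay for replacing h by g in that
  decrease, which costs at most 1/2 of it.\<close>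

lemma extragradient_residual_contraction:
  fixes G :: "'a::real_inner \<Rightarrow> 'a"
  assumes strong: "\<And>u v. (G u - G v) \<bullet> (u - v) \<ge> \<mu> * (norm (u - v))\<^sup>2"
    and lip: "\<And>u v. norm (G u - G v) \<le> norm (u - v) / 4"
    and \<mu>: "0 \<le> \<mu>" "\<mu> \<le> 1/8"
  shows "norm (G (x - G (x - G x))) \<le> (1 - 2/3 * \<mu>) * norm (G x)"
proof -
  define g h p where "g = G x" "h = G (x - g)" "p = G (x - h)"
  have mono: "(g - p) \<bullet> h \<ge> \<mu> * (norm h)\<^sup>2"
    using strong[of x "x - h"] by (simp add: g_h_p_def)
  have "norm (h - p) \<le> norm (h - g) / 4"
    using lip[of "x - g" "x - h"] by (simp add: g_h_p_def)
  then have "(norm (h - p))\<^sup>2 \<le> (norm (h - g) / 4)\<^sup>2"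
    by (intro power_mono) auto
  then have lip': "(norm (h - p))\<^sup>2 \<le> (norm (h - g))\<^sup>2 / 16"
    by (simp add: power_divide)
  have id: "(norm p)\<^sup>2 = (norm g)\<^sup>2 + (norm (h - p))\<^sup>2 - (norm (h - g))\<^sup>2 - 2 * ((g - p) \<bullet> h)"
    by (simp add: power2_norm_eq_inner algebra_simps inner_commute)
  have "(norm g)\<^sup>2 \<le> 3/2 * (norm h)\<^sup>2 + 3 * (norm (h - g))\<^sup>2"
    using norm_square_young[of g h] by (simp add: norm_minus_commute)
  from mult_left_mono[OF this \<mu>(1)]
  have young: "\<mu> * (norm g)\<^sup>2 \<le> 3/2 * (\<mu> * (norm h)\<^sup>2) + 3 * (\<mu> * (norm (h - g))\<^sup>2)"
    by (simp add: algebra_simps)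
  have small: "\<mu> * (norm (h - g))\<^sup>2 \<le> 1/8 * (norm (h - g))\<^sup>2"
    using \<mu> by (intro mult_right_mono) auto
  have "0 \<le> (norm (h - g))\<^sup>2"
    by simp
  with id mono lip' young small have "(norm p)\<^sup>2 \<le> (norm g)\<^sup>2 - 4/3 * (\<mu> * (norm g)\<^sup>2)"
    by linarith
  \<comment> \<open>Completing the square, so that the square root can be taken.\<close>
  also have "\<dots> \<le> (norm g)\<^sup>2 - 4/3 * (\<mu> * (norm g)\<^sup>2) + (2/3 * \<mu> * norm g)\<^sup>2"
    by simp
  also have "\<dots> = ((1 - 2/3 * \<mu>) * norm g)\<^sup>2"
    by (simp add: power2_eq_square algebra_simps)
  finally have "norm p \<le> (1 - 2/3 * \<mu>) * norm g"
    by (rule power2_le_imp_le) (use \<mu> in auto)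
  then show ?thesis
    by (simp add: g_h_p_def)
qed

text \<open>Here \<open>u\<close> will be the zero of \<open>F\<close> and \<open>a\<close> the
  anchor \<open>x0\<close>. Since \<open>u\<close> need not be a zero of the regularized
  \<open>G\<close>, the contraction towards \<open>u\<close> carries the bias
  \<open>\<mu> * (norm (a - u))\<^sup>2\<close>.\<close>

lemma extragradient_distance_step:
  fixes G :: "'a::real_inner \<Rightarrow> 'a"
  assumes regularized: "\<And>y. G y \<bullet> (y - u) \<ge> \<mu> * ((y - a) \<bullet> (y - u))"
    and lip: "\<And>u v. norm (G u - G v) \<le> norm (u - v) / 4"
    and \<mu>: "0 \<le> \<mu>" "\<mu> \<le> 1/8"
  shows "(norm (x - G (x - G x) - u))\<^sup>2
    \<le> (1 - 2/3 * \<mu>) * (norm (x - u))\<^sup>2 + \<mu> * (norm (a - u))\<^sup>2"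
proof -
  define g y h where "g = G x" "y = x - g" "h = G y"
  have "norm (h - g) \<le> norm g / 4"
    using lip[of y x] by (simp add: g_y_h_def)
  then have "(norm (h - g))\<^sup>2 \<le> (norm g / 4)\<^sup>2"
    by (intro power_mono) auto
  then have lip': "(norm (h - g))\<^sup>2 \<le> (norm g)\<^sup>2 / 16"
    by (simp add: power_divide)
  have id: "(norm (x - h - u))\<^sup>2
      = (norm (x - u))\<^sup>2 - 2 * (h \<bullet> (y - u)) + (norm (h - g))\<^sup>2 - (norm g)\<^sup>2"
    unfolding g_y_h_def(2) by (simp add: power2_norm_eq_inner algebra_simps inner_commute)
  \<comment> \<open>Polarization; the term \<open>(norm (y - a))\<^sup>2\<close> is then
    dropped.\<close>
  have "2 * ((y - a) \<bullet> (y - u)) = (norm (y - a))\<^sup>2 + (norm (y - u))\<^sup>2 - (norm (a - u))\<^sup>2"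
    by (simp add: power2_norm_eq_inner algebra_simps inner_commute)
  then have "(norm (y - u))\<^sup>2 - (norm (a - u))\<^sup>2 \<le> 2 * ((y - a) \<bullet> (y - u))"
    by simp
  from mult_left_mono[OF this \<mu>(1)] regularized[of y]
  have mono: "\<mu> * (norm (y - u))\<^sup>2 - \<mu> * (norm (a - u))\<^sup>2 \<le> 2 * (h \<bullet> (y - u))"
    by (simp add: g_y_h_def(3) algebra_simps)
  have "(norm (x - u))\<^sup>2 \<le> 3/2 * (norm (y - u))\<^sup>2 + 3 * (norm g)\<^sup>2"
    using norm_square_young[of "x - u" "y - u"] by (simp add: g_y_h_def(2))
  from mult_left_mono[OF this \<mu>(1)]
  have young: "\<mu> * (norm (x - u))\<^sup>2 \<le> 3/2 * (\<mu> * (norm (y - u))\<^sup>2) + 3 * (\<mu> * (norm g)\<^sup>2)"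
    by (simp add: algebra_simps)
  have small: "\<mu> * (norm g)\<^sup>2 \<le> 1/8 * (norm g)\<^sup>2"
    using \<mu> by (intro mult_right_mono) auto
  have "0 \<le> (norm g)\<^sup>2"
    by simp
  with id mono lip' young small
  have "(norm (x - h - u))\<^sup>2
      \<le> (norm (x - u))\<^sup>2 - 2/3 * (\<mu> * (norm (x - u))\<^sup>2) + \<mu> * (norm (a - u))\<^sup>2"
    by linarith
  then show ?thesis
    by (simp add: g_y_h_def algebra_simps)
qed

theorem theorem2:
  fixes F :: "'a::{real_inner, complete_space} \<Rightarrow> 'a"
    and xstar x0 :: 'a
    and L R \<eta> :: real
    and \<delta> :: "nat \<Rightarrow> real"
    and G :: "nat \<Rightarrow> 'a \<Rightarrow> 'a"
    and x xhalf :: "nat \<Rightarrow> 'a"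
  assumes "L > 0"
    and "monotone_operator F"
    and "L-lipschitz_on UNIV F"
    and "F xstar = 0"
    and "R = norm (x0 - xstar)"
    and "\<eta> = 1 / (8 * L)"
    and "\<And>k. \<delta> k = 4 / (real k + 32)"
    and "\<And>k z. G k z = \<eta> *\<^sub>R F z + \<delta> k *\<^sub>R (z - x0)"
    and "x 0 = x0"
    and "\<And>k. xhalf k = x k - G k (x k)"
    and "\<And>k. x (Suc k) = x k - G k (xhalf k)"
  shows "\<forall>k\<ge>1. norm (F (x k)) \<le> 128 * L * R / (real k + 31)"
proof -
  note F_mono = assms(2)[unfolded monotone_operator_def, rule_format]
  note \<delta>_eq = assms(7) and G_eq = assms(8)
  have \<eta>: "\<eta> > 0" "\<eta> * L = 1/8"
    using assms(1,6) by auto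
  \<comment> \<open>The shift 32 makes \<open>\<delta> 0 = 1/8\<close>, the largest \<mu> that both
    lemmas allow. Together with \<open>\<eta> * L = 1/8\<close> it gives the Lipschitz constant
    1/4.\<close>
  have \<delta>: "0 \<le> \<delta> k" "\<delta> k \<le> 1/8" for k
    by (auto simp: \<delta>_eq field_simps)
  have R: "R \<ge> 0"
    by (simp add: assms(5))
  have x_Suc: "x (Suc k) = x k - G k (x k - G k (x k))" for k
    by (simp add: assms(10,11))

  have F_lip: "\<eta> * norm (F u - F v) \<le> norm (u - v) / 8" for u v
  proof -
    have "norm (F u - F v) \<le> L * norm (u - v)"
      using lipschitz_onD[OF assms(3), of u v] by (simp add: dist_norm)
    then have "\<eta> * norm (F u - F v) \<le> \<eta> * (L * norm (u - v))"
      using \<eta> by (intro mult_left_mono) auto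
    also have "\<dots> = (\<eta> * L) * norm (u - v)"
      by simp
    finally show ?thesis
      using \<eta> by simp
  qed
  have G_diff: "G k u - G k v = \<eta> *\<^sub>R (F u - F v) + \<delta> k *\<^sub>R (u - v)" for k u v
    by (simp add: G_eq algebra_simps)
  have G_lip: "norm (G k u - G k v) \<le> norm (u - v) / 4" for k u v
  proof -
    have "norm (G k u - G k v) \<le> \<eta> * norm (F u - F v) + \<delta> k * norm (u - v)"
      unfolding G_diff using norm_triangle_ineq[of "\<eta> *\<^sub>R (F u - F v)" "\<delta> k *\<^sub>R (u - v)"] \<eta> \<delta>(1)[of k]
      by simp
    moreover have "\<delta> k * norm (u - v) \<le> 1/8 * norm (u - v)"
      using \<delta> by (intro mult_right_mono) auto
    ultimately show ?thesis
      using F_lip[of u v] by simp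
  qed
  have G_strong: "(G k u - G k v) \<bullet> (u - v) \<ge> \<delta> k * (norm (u - v))\<^sup>2" for k u v
    unfolding G_diff using mult_nonneg_nonneg[OF less_imp_le[OF \<eta>(1)] F_mono[of u v]]
    by (simp add: inner_add_left power2_norm_eq_inner)
  have G_regularized: "G k y \<bullet> (y - xstar) \<ge> \<delta> k * ((y - x0) \<bullet> (y - xstar))" for k y
    unfolding G_eq using mult_nonneg_nonneg[OF less_imp_le[OF \<eta>(1)] F_mono[of y xstar]]
    by (simp add: inner_add_left assms(4))

  \<comment> \<open>\<open>3/2 * R\<^sup>2\<close> is the fixed point of the recursion in
    \<open>extragradient_distance_step\<close>, whatever the value of
    \<open>\<delta> k\<close>.\<close>
  have dist_sq: "(norm (x k - xstar))\<^sup>2 \<le> 3/2 * R\<^sup>2" for k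
  proof (induction k)
    case 0
    then show ?case
      by (simp add: assms(5,9))
  next
    case (Suc k)
    have "(norm (x (Suc k) - xstar))\<^sup>2 \<le> (1 - 2/3 * \<delta> k) * (norm (x k - xstar))\<^sup>2 + \<delta> k * R\<^sup>2"
      unfolding x_Suc assms(5)
      by (rule extragradient_distance_step[OF G_regularized G_lip \<delta>])
    also have "\<dots> \<le> (1 - 2/3 * \<delta> k) * (3/2 * R\<^sup>2) + \<delta> k * R\<^sup>2"
      using Suc \<delta>(2)[of k] by (intro add_right_mono mult_left_mono) auto
    also have "\<dots> = 3/2 * R\<^sup>2"
      by (simp add: field_simps)
    finally show ?case .
  qed
  have anchor: "norm (x k - x0) \<le> 9/4 * R" for k
  proof -
    \<comment> \<open>5/4 is a rational upper bound for the square root of 3/2; adding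
      \<open>norm (xstar - x0) = R\<close> gives 9/4.\<close>
    have "3/2 * R\<^sup>2 \<le> (5/4 * R)\<^sup>2"
      by (simp add: power2_eq_square)
    with dist_sq[of k] have "(norm (x k - xstar))\<^sup>2 \<le> (5/4 * R)\<^sup>2"
      by (rule order_trans)
    then have "norm (x k - xstar) \<le> 5/4 * R"
      by (rule power2_le_imp_le) (use R in simp)
    moreover have "norm (x k - x0) \<le> norm (x k - xstar) + norm (xstar - x0)"
      using norm_triangle_ineq[of "x k - xstar" "xstar - x0"] by simp
    ultimately show ?thesis
      by (simp add: assms(5) norm_minus_commute)
  qed

  have residual: "norm (G k (x k)) \<le> 7 * R / (real k + 32)" for k
  proof (induction k)
    case 0
    \<comment> \<open>The regularization vanishes at \<open>x0\<close>, and 1/8 is below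
      7/32.\<close>
    have "norm (G 0 (x 0)) = \<eta> * norm (F x0 - F xstar)"
      using \<eta> by (simp add: G_eq assms(4,9))
    also have "\<dots> \<le> R / 8"
      using F_lip[of x0 xstar] by (simp add: assms(5))
    finally show ?case
      using R by simp
  next
    case (Suc k)
    define n where "n = real k + 32"
    have n: "n \<ge> 32" "real (Suc k) + 32 = n + 1"
      by (auto simp: n_def)
    have diff: "\<delta> k - \<delta> (Suc k) = 4 / (n * (n + 1))"
      using n by (simp add: \<delta>_eq n_def field_simps)
    have "G (Suc k) (x (Suc k)) = G k (x (Suc k)) - (\<delta> k - \<delta> (Suc k)) *\<^sub>R (x (Suc k) - x0)"
      by (simp add: G_eq algebra_simps)
    then have "norm (G (Suc k) (x (Suc k)))
        \<le> norm (G k (x (Suc k))) + norm ((\<delta> k - \<delta> (Suc k)) *\<^sub>R (x (Suc k) - x0))"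
      by (simp only: norm_triangle_ineq4)
    also have "\<dots> = norm (G k (x (Suc k))) + 4 / (n * (n + 1)) * norm (x (Suc k) - x0)"
      using n by (simp add: diff)
    also have "\<dots> \<le> (1 - 2/3 * \<delta> k) * norm (G k (x k)) + 4 / (n * (n + 1)) * norm (x (Suc k) - x0)"
      using extragradient_residual_contraction[OF G_strong G_lip \<delta>] by (simp add: x_Suc)
    also have "\<dots> \<le> (1 - 2/3 * \<delta> k) * (7 * R / n) + 4 / (n * (n + 1)) * (9/4 * R)"
      using Suc \<delta>(2)[of k] n anchor[of "Suc k"]
      by (intro add_mono mult_left_mono) (auto simp: n_def)
    \<comment> \<open>The contraction gains \<open>56/3 * R / n\<^sup>2\<close>. Lowering the bound
      from \<open>7 * R / n\<close> to \<open>7 * R / (n + 1)\<close> and the change of \<delta> use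
      up \<open>(7 + 9) * R / (n * (n + 1))\<close>; the surplus is the subtracted term.\<close>
    also have "\<dots> = 7 * R / (n + 1) - R * (8 * n + 56) / (3 * n\<^sup>2 * (n + 1))"
      using n(1) unfolding \<delta>_eq n_def[symmetric]
      by (simp add: divide_simps power2_eq_square) (simp add: algebra_simps)
    also have "\<dots> \<le> 7 * R / (n + 1)"
      using n R by simp
    finally show ?case
      by (simp only: n(2))
  qed

  \<comment> \<open>The residual contributes 7 and the regularization \<open>4 * 9/4 = 9\<close>;
    division by \<open>\<eta> = 1 / (8 * L)\<close> turns 16 into 128.\<close>
  have bound: "norm (F (x k)) \<le> 128 * L * R / (real k + 32)" for k
  proof -
    have "\<eta> *\<^sub>R F (x k) = G k (x k) - \<delta> k *\<^sub>R (x k - x0)"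
      by (simp add: G_eq)
    then have "\<eta> * norm (F (x k)) \<le> norm (G k (x k)) + \<delta> k * norm (x k - x0)"
      using norm_triangle_ineq4[of "G k (x k)" "\<delta> k *\<^sub>R (x k - x0)"] \<eta>(1) \<delta>(1)[of k]
      by (metis abs_of_nonneg less_imp_le norm_scaleR)
    also have "\<dots> \<le> 7 * R / (real k + 32) + \<delta> k * (9/4 * R)"
      using residual anchor \<delta> by (intro add_mono mult_left_mono) auto
    also have "\<dots> = 16 * R / (real k + 32)"
      unfolding \<delta>_eq by (simp add: divide_simps)
    finally show ?thesis
      using assms(1) by (simp add: assms(6) field_simps)
  qed
  show ?thesis
  proof (intro allI impI)
    fix k :: nat
    assume "k \<ge> 1"
    have "128 * L * R / (real k + 32) \<le> 128 * L * R / (real k + 31)"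
      using assms(1) R by (intro divide_left_mono) auto
    with bound[of k] show "norm (F (x k)) \<le> 128 * L * R / (real k + 31)"
      by simp
  qed
qed

end
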